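(* In the setting described in the context, let $\hat u\in L^\infty(\Omega)$ be a weak solution of the balance law, with Helmholtz decomposition $\boldsymbol f(\hat u)=\nabla q+\nabla^\perp\psi$, $q\in H^1_{0,\Gamma_C}(\Omega)$, $\psi\in H^1_{0,\Gamma_I}(\Omega)$. Assume that there are constants $C_0>0$ and $\beta_{\hat u},\beta_q,\beta_\psi>0$, independent of $h$, such that for every $h$ there exist $\hat u^h\in\mathcal U^h$, $\hat q^h\in\mathcal V^h_{\Gamma_C}$, $\hat\psi^h\in\mathcal V^h_{\Gamma_I}$ with $$\|\hat u^h-\hat u\|\le C_0h^{\beta_{\hat u}}\|\hat u\|_{\beta_{\hat u}},\quad\|\nabla(\hat q^h-q)\|\le C_0h^{\beta_q}\|q\|_{\beta_q+1},\quad\|\nabla(\hat\psi^h-\psi)\|\le C_0h^{\beta_\psi}\|\psi\|_{\beta_\psi+1}.$$ Assume that for every $h$ the functional $v^h\mapsto\mathcal G^h(v^h;q)$ has a minimizer $u^h$ over $\mathcal U^h$, and that the $\hat u^h$ above can be selected to form a bounded sequence in $L^\infty(\Omega)$ as $h\to0$, i.e. there is a constant $B>0$ with $\|\hat u\|_{L^\infty(\Omega)}\le B$ and $\|\hat u^h\|_{L^\infty(\Omega)}\le B$ for all $h$ in the sequence of mesh parameters. Then there are constants $C>0$ and $C_{\boldsymbol f,B}>0$, independent of $h$, where $C_{\boldsymbol f,B}$ generally depends on $\boldsymbol f$ and $B$, such that $$\mathcal G^h(u^h;q)\le C_{\boldsymbol f,B}h^{2\beta_{\hat u}}\|\hat u\|_{\beta_{\hat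 u}}^2+Ch^{2\beta_q}\|q\|_{\beta_q+1}^2+Ch^{2\beta_\psi}\|\psi\|_{\beta_\psi+1}^2.$$ In particular, $\mathcal G^h(u^h;q)\to0$ as $h\to0$.
   Context: **Domain and spaces.** $\Omega\subset\mathbb R^2$ (coordinates $(t,x)$) is open, bounded, simply connected with Lipschitz boundary $\Gamma$ and unit outward normal $\boldsymbol n$. $\nabla v=[\partial_t v,\partial_x v]$, $\nabla^\perp v=[\partial_x v,-\partial_t v]$. $\|\cdot\|$ and $(\cdot,\cdot)$ are the norm and inner product in $L^2(\Omega)$ and $[L^2(\Omega)]^2$; $\|\cdot\|_s$ is the norm of the Sobolev space $H^s(\Omega)$ (a bound involving $\|w\|_s$ implicitly presumes $w\in H^s(\Omega)$). $\Gamma=\overline{\Gamma_I}\cup\overline{\Gamma_C}$, where $\Gamma_I$ (the inflow part of the boundary, regarded as given) and $\Gamma_C$ are disjoint relatively open subcurves of nonzero measure with finitely many connected components. For $\Gamma_S\subset\Gamma$, $H^1_{0,\Gamma_S}(\Omega)=\{\phi\in H^1(\Omega):\phi=0\text{ on }\Gamma_S\}$ with norm $|\phi|_1=\|\nabla\phi\|$. **Helmholtz decomposition.** Every $\boldsymbol v\in[L^2(\Omega)]^2$ has a unique $L^2$-orthogonal decomposition $\boldsymbol v=\nabla q_{\boldsymbol v}+\nabla^\perp\psi_{\boldsymbol v}$ with $q_{\boldsymbol v}\in H^1_{0,\Gamma_C}(\Omega)$ and $\psi_{\boldsymbol v}\in H^1_{0,\Gamma_I}(\Omega)$, where $(\nabla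 q_{\boldsymbol v},\nabla\phi)=(\boldsymbol v,\nabla\phi)$ for all $\phi\in H^1_{0,\Gamma_C}(\Omega)$ and $(\nabla^\perp\psi_{\boldsymbol v},\nabla^\perp\nu)=(\boldsymbol v,\nabla^\perp\nu)$ for all $\nu\in H^1_{0,\Gamma_I}(\Omega)$. **Balance law.** $\nabla\cdot\boldsymbol f(u)=r$ in $\Omega$, $u=g$ on $\Gamma_I$, with $r\in L^2(\Omega)$, $g\in L^\infty(\Gamma_I)$, and $\boldsymbol f=[f_1,f_2]:\mathbb R\to\mathbb R^2$ locally Lipschitz: for every compact $J\subset\mathbb R$ there is $K_{\boldsymbol f,J}>0$ with $|f_i(a)-f_i(b)|\le K_{\boldsymbol f,J}|a-b|$ for $a,b\in J$, $i=1,2$. A function $\hat u\in L^\infty(\Omega)$ is a weak solution if $-(\boldsymbol f(\hat u),\nabla\phi)=(r,\phi)-\int_{\Gamma_I}\boldsymbol f(g)\cdot\boldsymbol n\,\phi\,d\sigma$ for all $\phi\in H^1_{0,\Gamma_C}(\Omega)$. **Functionals.** $h$ ranges over a sequence of positive mesh parameters tending to $0$; for each $h$, $\mathcal U^h\subset L^\infty(\Omega)$, $\mathcal V^h_{\Gamma_C}\subset H^1_{0,\Gamma_C}(\Omega)$, $\mathcal V^h_{\Gamma_I}\subset H^1_{0,\Gamma_I}(\Omega)$ are (finite-dimensional) finite element spaces. For $v\in L^\infty(\Omega)$, $p\in H^1_{0,\Gamma_C}(\Omega)$, $\mu\in H^1_{0,\Gamma_I}(\Omega)$, $$\mathcal F(v,p,\mu;q)=\|\boldsymbol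 f(v)-\nabla p-\nabla^\perp\mu\|^2+\|\nabla p-\nabla q\|^2,\qquad \mathcal G^h(v;q)=\min_{p^h\in\mathcal V^h_{\Gamma_C},\,\mu^h\in\mathcal V^h_{\Gamma_I}}\mathcal F(v,p^h,\mu^h;q).$$ *)

theory Defs
  imports "HOL-Analysis.Analysis" "HOL-Probability.Essential_Supremum"
begin

text \<open>
  The plane is \<^typ>\<open>real \<times> real\<close> (with its Euclidean norm), a point being \<open>(t, x)\<close>.
  Elements of Lebesgue and Sobolev spaces are represented by functions; identities between such
  functions are therefore stated almost everywhere.
\<close>

section \<open>Lebesgue spaces\<close>

definition L2 :: "'a measure \<Rightarrow> ('a \<Rightarrow> 'b::euclidean_space) set" where
  "L2 M = {v. v \<in> borel_measurable M \<and> integrable M (\<lambda>z. (norm (v z))\<^sup>2)}"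

definition L2_inner :: "'a measure \<Rightarrow> ('a \<Rightarrow> 'b::euclidean_space) \<Rightarrow> ('a \<Rightarrow> 'b) \<Rightarrow> real" where
  "L2_inner M v w = (LINT z|M. v z \<bullet> w z)"

definition L2_norm :: "'a measure \<Rightarrow> ('a \<Rightarrow> 'b::euclidean_space) \<Rightarrow> real" where
  "L2_norm M v = sqrt (LINT z|M. (norm (v z))\<^sup>2)"

definition Linf_norm :: "'a measure \<Rightarrow> ('a \<Rightarrow> real) \<Rightarrow> ereal" where
  "Linf_norm M v = esssup M (\<lambda>z. ereal \<bar>v z\<bar>)"

definition Linf :: "'a measure \<Rightarrow> ('a \<Rightarrow> real) set" where
  "Linf M = {v. v \<in> borel_measurable M \<and> Linf_norm M v < \<infinity>}"


section \<open>Weak derivatives and Sobolev spaces\<close>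

definition partial_t :: "(real \<times> real \<Rightarrow> real) \<Rightarrow> real \<times> real \<Rightarrow> real" where
  "partial_t \<phi> = (\<lambda>(t, x). deriv (\<lambda>s. \<phi> (s, x)) t)"

definition partial_x :: "(real \<times> real \<Rightarrow> real) \<Rightarrow> real \<times> real \<Rightarrow> real" where
  "partial_x \<phi> = (\<lambda>(t, x). deriv (\<lambda>y. \<phi> (t, y)) x)"

definition partials :: "nat \<Rightarrow> nat \<Rightarrow> (real \<times> real \<Rightarrow> real) \<Rightarrow> real \<times> real \<Rightarrow> real" where
  "partials a b \<phi> = (partial_t ^^ a) ((partial_x ^^ b) \<phi>)"

text \<open>
  Total differentiability of every \<open>\<partial>\<^sub>t\<^sup>a \<partial>\<^sub>x\<^sup>b \<phi>\<close> makes all mixed derivatives exist, commute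
  and be continuous, so this is the class of infinitely differentiable functions.
\<close>

definition smooth :: "(real \<times> real \<Rightarrow> real) \<Rightarrow> bool" where
  "smooth \<phi> \<longleftrightarrow> (\<forall>a b z. partials a b \<phi> differentiable (at z))"

definition test_function :: "(real \<times> real) set \<Rightarrow> (real \<times> real \<Rightarrow> real) \<Rightarrow> bool" where
  "test_function \<Omega> \<phi> \<longleftrightarrow>
     smooth \<phi> \<and> (\<exists>K. compact K \<and> K \<subseteq> \<Omega> \<and> (\<forall>z. z \<notin> K \<longrightarrow> \<phi> z = 0))"

text \<open>\<open>g\<close> is the square integrable weak derivative \<open>\<partial>\<^sub>t\<^sup>a \<partial>\<^sub>x\<^sup>b w\<close>.\<close>

definition has_weak_partials ::
    "(real \<times> real) set \<Rightarrow> nat \<Rightarrow> nat \<Rightarrow> (real \<times> real \<Rightarrow> real) \<Rightarrow> (real \<times> real \<Rightarrow> real) \<Rightarrow> bool" where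
  "has_weak_partials \<Omega> a b w g \<longleftrightarrow>
     w \<in> L2 (lebesgue_on \<Omega>) \<and> g \<in> L2 (lebesgue_on \<Omega>) \<and>
     (\<forall>\<phi>. test_function \<Omega> \<phi> \<longrightarrow>
        (LINT z|lebesgue_on \<Omega>. w z * partials a b \<phi> z) =
        (-1) ^ (a + b) * (LINT z|lebesgue_on \<Omega>. g z * \<phi> z))"

text \<open>A representative; weak derivatives are unique up to null sets.\<close>

definition weak_partials ::
    "(real \<times> real) set \<Rightarrow> nat \<Rightarrow> nat \<Rightarrow> (real \<times> real \<Rightarrow> real) \<Rightarrow> real \<times> real \<Rightarrow> real" where
  "weak_partials \<Omega> a b w = (SOME g. has_weak_partials \<Omega> a b w g)"

text \<open>
  The squared Sobolev--Slobodeckij seminorm of order \<open>0 < \<theta> < 1\<close>; the exponent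
  \<open>2 + 2 \<theta>\<close> is the dimension plus \<open>2 \<theta>\<close>.
\<close>

definition slobodeckij :: "(real \<times> real) set \<Rightarrow> real \<Rightarrow> (real \<times> real \<Rightarrow> real) \<Rightarrow> ennreal" where
  "slobodeckij \<Omega> \<theta> v =
     (\<integral>\<^sup>+ y. \<integral>\<^sup>+ z. ennreal ((v y - v z)\<^sup>2 / norm (y - z) powr (2 + 2 * \<theta>))
        \<partial>lebesgue_on \<Omega> \<partial>lebesgue_on \<Omega>)"

text \<open>\<open>H\<^sup>s(\<Omega>)\<close> for real \<open>s \<ge> 0\<close>.\<close>

definition sobolev :: "(real \<times> real) set \<Rightarrow> real \<Rightarrow> (real \<times> real \<Rightarrow> real) set" where
  "sobolev \<Omega> s = {w.
     (\<forall>a b. a + b \<le> nat \<lfloor>s\<rfloor> \<longrightarrow> (\<exists>g. has_weak_partials \<Omega> a b w g)) \<and>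
     (frac s > 0 \<longrightarrow>
        (\<forall>a b. a + b = nat \<lfloor>s\<rfloor> \<longrightarrow> slobodeckij \<Omega> (frac s) (weak_partials \<Omega> a b w) < \<infinity>))}"

definition sobolev_norm :: "(real \<times> real) set \<Rightarrow> real \<Rightarrow> (real \<times> real \<Rightarrow> real) \<Rightarrow> real" where
  "sobolev_norm \<Omega> s w = (let m = nat \<lfloor>s\<rfloor> in
     sqrt ((\<Sum>a\<le>m. \<Sum>b\<le>m - a. (L2_norm (lebesgue_on \<Omega>) (weak_partials \<Omega> a b w))\<^sup>2) +
           (if frac s = 0 then 0
            else \<Sum>a\<le>m. enn2real (slobodeckij \<Omega> (frac s) (weak_partials \<Omega> a (m - a) w)))))"

definition grad ::
    "(real \<times> real) set \<Rightarrow> (real \<times> real \<Rightarrow> real) \<Rightarrow> real \<times> real \<Rightarrow> real \<times> real" where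
  "grad \<Omega> v z = (weak_partials \<Omega> 1 0 v z, weak_partials \<Omega> 0 1 v z)"

definition grad_perp ::
    "(real \<times> real) set \<Rightarrow> (real \<times> real \<Rightarrow> real) \<Rightarrow> real \<times> real \<Rightarrow> real \<times> real" where
  "grad_perp \<Omega> v z = (weak_partials \<Omega> 0 1 v z, - weak_partials \<Omega> 1 0 v z)"


section \<open>The boundary\<close>

text \<open>
  Near each boundary point, in Cartesian coordinates \<open>(s, y)\<close> given by a rotation, \<open>\<Omega>\<close> is the
  set of points above the graph of a Lipschitz function.
\<close>

definition lipschitz_boundary :: "(real \<times> real) set \<Rightarrow> bool" where
  "lipschitz_boundary \<Omega> \<longleftrightarrow> (\<forall>z\<in>frontier \<Omega>. \<exists>e \<gamma> r d L.
     norm e = 1 \<and> r > 0 \<and> d > 0 \<and> L-lipschitz_on (UNIV :: real set) (\<gamma> :: real \<Rightarrow> real) \<and>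
     (\<forall>s y. \<bar>s\<bar> < r \<and> \<bar>y\<bar> < d \<longrightarrow>
        (z + s *\<^sub>R (snd e, - fst e) + y *\<^sub>R e \<in> \<Omega> \<longleftrightarrow> \<gamma> s < y)))"

text \<open>
  One-dimensional Hausdorff outer measure, normalised so that it is length on curves. It is a
  metric outer measure, hence a measure on the Borel sets; restricted to \<open>\<Gamma>\<close> it is the arc
  length measure \<open>d\<sigma>\<close>.
\<close>

definition hausdorff1 :: "(real \<times> real) set \<Rightarrow> ennreal" where
  "hausdorff1 A = (SUP \<delta>\<in>{0::real<..}.
     INF C\<in>{C :: nat \<Rightarrow> (real \<times> real) set.
              A \<subseteq> (\<Union>i. C i) \<and> (\<forall>i. bounded (C i) \<and> diameter (C i) \<le> \<delta>)}.
       \<Sum>i. ennreal (diameter (C i)))"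

definition boundary_measure :: "(real \<times> real) set \<Rightarrow> (real \<times> real) measure" where
  "boundary_measure \<Omega> =
     restrict_space (measure_of UNIV (sets borel) hausdorff1) (frontier \<Omega>)"

text \<open>
  \<open>\<nu>\<close> is the unit outward normal at \<open>z\<close>: to first order at \<open>z\<close>, \<open>\<Omega>\<close> is the half-plane
  \<open>{y. (y - z) \<bullet> \<nu> < 0}\<close>. For a Lipschitz boundary such a \<open>\<nu>\<close> exists at almost every boundary
  point, and it is unique.
\<close>

definition is_outward_normal ::
    "(real \<times> real) set \<Rightarrow> real \<times> real \<Rightarrow> real \<times> real \<Rightarrow> bool" where
  "is_outward_normal \<Omega> z \<nu> \<longleftrightarrow> norm \<nu> = 1 \<and>
     (\<forall>\<epsilon>>0. \<exists>\<rho>>0. \<forall>y\<in>ball z \<rho>.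
        (y \<in> \<Omega> \<longrightarrow> (y - z) \<bullet> \<nu> \<le> \<epsilon> * norm (y - z)) \<and>
        (y \<notin> \<Omega> \<longrightarrow> (y - z) \<bullet> \<nu> \<ge> - \<epsilon> * norm (y - z)))"

definition outward_normal :: "(real \<times> real) set \<Rightarrow> real \<times> real \<Rightarrow> real \<times> real" where
  "outward_normal \<Omega> z = (THE \<nu>. is_outward_normal \<Omega> z \<nu>)"

text \<open>
  The trace operator \<open>H\<^sup>1(\<Omega>) \<rightarrow> L\<^sup>2(\<Gamma>)\<close> as the continuous extension of the restriction to the
  boundary, from the functions that are smooth up to the boundary.
\<close>

definition has_trace ::
    "(real \<times> real) set \<Rightarrow> (real \<times> real \<Rightarrow> real) \<Rightarrow> (real \<times> real \<Rightarrow> real) \<Rightarrow> bool" where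
  "has_trace \<Omega> \<phi> \<tau> \<longleftrightarrow> \<phi> \<in> sobolev \<Omega> 1 \<and> \<tau> \<in> L2 (boundary_measure \<Omega>) \<and>
     (\<exists>\<Phi> :: nat \<Rightarrow> real \<times> real \<Rightarrow> real. (\<forall>k. smooth (\<Phi> k)) \<and>
        (\<lambda>k. sobolev_norm \<Omega> 1 (\<lambda>z. \<Phi> k z - \<phi> z)) \<longlonglongrightarrow> 0 \<and>
        (\<lambda>k. L2_norm (boundary_measure \<Omega>) (\<lambda>z. \<Phi> k z - \<tau> z)) \<longlonglongrightarrow> 0)"

definition trace :: "(real \<times> real) set \<Rightarrow> (real \<times> real \<Rightarrow> real) \<Rightarrow> real \<times> real \<Rightarrow> real" where
  "trace \<Omega> \<phi> = (SOME \<tau>. has_trace \<Omega> \<phi> \<tau>)"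

definition H1_0 :: "(real \<times> real) set \<Rightarrow> (real \<times> real) set \<Rightarrow> (real \<times> real \<Rightarrow> real) set" where
  "H1_0 \<Omega> S = {\<phi> \<in> sobolev \<Omega> 1. AE z in boundary_measure \<Omega>. z \<in> S \<longrightarrow> trace \<Omega> \<phi> z = 0}"

definition boundary_partition ::
    "(real \<times> real) set \<Rightarrow> (real \<times> real) set \<Rightarrow> (real \<times> real) set \<Rightarrow> bool" where
  "boundary_partition \<Omega> \<Gamma>\<^sub>I \<Gamma>\<^sub>C \<longleftrightarrow>
     frontier \<Omega> = closure \<Gamma>\<^sub>I \<union> closure \<Gamma>\<^sub>C \<and> \<Gamma>\<^sub>I \<inter> \<Gamma>\<^sub>C = {} \<and>
     (\<forall>S\<in>{\<Gamma>\<^sub>I, \<Gamma>\<^sub>C}. openin (top_of_set (frontier \<Omega>)) S \<and>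
        emeasure (boundary_measure \<Omega>) S \<noteq> 0 \<and> finite (components S))"


section \<open>Balance law and Helmholtz decomposition\<close>

definition locally_lipschitz_flux :: "(real \<Rightarrow> real \<times> real) \<Rightarrow> bool" where
  "locally_lipschitz_flux f \<longleftrightarrow> (\<forall>J. compact J \<longrightarrow> (\<exists>K>0. \<forall>a\<in>J. \<forall>b\<in>J.
     \<bar>fst (f a) - fst (f b)\<bar> \<le> K * \<bar>a - b\<bar> \<and> \<bar>snd (f a) - snd (f b)\<bar> \<le> K * \<bar>a - b\<bar>))"

definition weak_solution ::
    "(real \<times> real) set \<Rightarrow> (real \<times> real) set \<Rightarrow> (real \<times> real) set \<Rightarrow> (real \<Rightarrow> real \<times> real) \<Rightarrow>
     (real \<times> real \<Rightarrow> real) \<Rightarrow> (real \<times> real \<Rightarrow> real) \<Rightarrow> (real \<times> real \<Rightarrow> real) \<Rightarrow> bool" where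
  "weak_solution \<Omega> \<Gamma>\<^sub>I \<Gamma>\<^sub>C f r g u \<longleftrightarrow> u \<in> Linf (lebesgue_on \<Omega>) \<and>
     (\<forall>\<phi>\<in>H1_0 \<Omega> \<Gamma>\<^sub>C.
        - L2_inner (lebesgue_on \<Omega>) (\<lambda>z. f (u z)) (grad \<Omega> \<phi>) =
        L2_inner (lebesgue_on \<Omega>) r \<phi> -
        (LINT z|restrict_space (boundary_measure \<Omega>) \<Gamma>\<^sub>I.
           (f (g z) \<bullet> outward_normal \<Omega> z) * trace \<Omega> \<phi> z))"

definition helmholtz_decomposition ::
    "(real \<times> real) set \<Rightarrow> (real \<times> real) set \<Rightarrow> (real \<times> real) set \<Rightarrow>
     (real \<times> real \<Rightarrow> real \<times> real) \<Rightarrow> (real \<times> real \<Rightarrow> real) \<Rightarrow> (real \<times> real \<Rightarrow> real) \<Rightarrow> bool" where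
  "helmholtz_decomposition \<Omega> \<Gamma>\<^sub>I \<Gamma>\<^sub>C v q \<psi> \<longleftrightarrow>
     q \<in> H1_0 \<Omega> \<Gamma>\<^sub>C \<and> \<psi> \<in> H1_0 \<Omega> \<Gamma>\<^sub>I \<and>
     (AE z in lebesgue_on \<Omega>. v z = grad \<Omega> q z + grad_perp \<Omega> \<psi> z) \<and>
     L2_inner (lebesgue_on \<Omega>) (grad \<Omega> q) (grad_perp \<Omega> \<psi>) = 0 \<and>
     (\<forall>\<phi>\<in>H1_0 \<Omega> \<Gamma>\<^sub>C. L2_inner (lebesgue_on \<Omega>) (grad \<Omega> q) (grad \<Omega> \<phi>) =
        L2_inner (lebesgue_on \<Omega>) v (grad \<Omega> \<phi>)) \<and>
     (\<forall>\<nu>\<in>H1_0 \<Omega> \<Gamma>\<^sub>I. L2_inner (lebesgue_on \<Omega>) (grad_perp \<Omega> \<psi>) (grad_perp \<Omega> \<nu>) =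
        L2_inner (lebesgue_on \<Omega>) v (grad_perp \<Omega> \<nu>))"


section \<open>Discrete spaces and least-squares functionals\<close>

text \<open>Finite-dimensional linear spaces of functions, as spans of finite families.\<close>

definition finite_dim_space :: "('a \<Rightarrow> real) set \<Rightarrow> bool" where
  "finite_dim_space V \<longleftrightarrow> (\<exists>(n::nat) (b :: nat \<Rightarrow> 'a \<Rightarrow> real).
     V = {v. \<exists>c :: nat \<Rightarrow> real. v = (\<lambda>z. \<Sum>i<n. c i * b i z)})"

definition LS_F ::
    "(real \<times> real) set \<Rightarrow> (real \<Rightarrow> real \<times> real) \<Rightarrow> (real \<times> real \<Rightarrow> real) \<Rightarrow>
     (real \<times> real \<Rightarrow> real) \<Rightarrow> (real \<times> real \<Rightarrow> real) \<Rightarrow> (real \<times> real \<Rightarrow> real) \<Rightarrow> real" where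
  "LS_F \<Omega> f v p \<mu> q =
     (L2_norm (lebesgue_on \<Omega>) (\<lambda>z. f (v z) - grad \<Omega> p z - grad_perp \<Omega> \<mu> z))\<^sup>2 +
     (L2_norm (lebesgue_on \<Omega>) (\<lambda>z. grad \<Omega> p z - grad \<Omega> q z))\<^sup>2"

text \<open>
  The infimum is a minimum for finite-dimensional \<open>V\<^sub>C\<close>, \<open>V\<^sub>I\<close>: it is the value of a linear
  least-squares problem over a finite-dimensional space.
\<close>

definition LS_G ::
    "(real \<times> real) set \<Rightarrow> (real \<Rightarrow> real \<times> real) \<Rightarrow> (real \<times> real \<Rightarrow> real) set \<Rightarrow>
     (real \<times> real \<Rightarrow> real) set \<Rightarrow> (real \<times> real \<Rightarrow> real) \<Rightarrow> (real \<times> real \<Rightarrow> real) \<Rightarrow> real" where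
  "LS_G \<Omega> f V\<^sub>C V\<^sub>I v q = (INF (p, \<mu>)\<in>V\<^sub>C \<times> V\<^sub>I. LS_F \<Omega> f v p \<mu> q)"

end

theory Submission
  imports Defs
begin

text \<open>
  Minimality gives \<open>G(u\<^sub>h; q) \<le> F(v, p, \<mu>; q)\<close> for the approximants \<open>v, p, \<mu>\<close> of the weak solution
  \<open>u\<close> and of \<open>q, \<psi>\<close>. Inserting \<open>f(u) = grad q + grad_perp \<psi>\<close> splits the first residual into
  \<open>f(v) - f(u)\<close>, \<open>grad (p - q)\<close> and \<open>grad_perp (\<mu> - \<psi>)\<close>, and the Lipschitz bound on \<open>[-B, B]\<close>
  controls the first of these.

  As weak derivatives are chosen representatives, \<open>grad (p - q) = grad p - grad q\<close> holds only
  almost everywhere and needs the fundamental lemma of the calculus of variations. This is obtained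
  from products of one-dimensional bumps, which converge boundedly to indicators of boxes, and the
  fact that boxes generate the Borel sets.
\<close>

section \<open>Smooth bumps on the line\<close>

definition flat_fun :: "nat \<Rightarrow> real \<Rightarrow> real" where
  "flat_fun n x = (if x > 0 then exp (- 1 / x) / x ^ n else 0)"

text \<open>Only the limit from the right has content: with \<open>y = 1 / x\<close> it becomes the
  limit of \<open>y ^ n / exp y\<close> at infinity.\<close>

lemma flat_fun_tendsto_0: "(flat_fun n \<longlongrightarrow> 0) (at 0)"
proof -
  have "(flat_fun n \<longlongrightarrow> 0) (at_left 0)"
    by (rule tendsto_eventually) (auto simp: flat_fun_def eventually_at_filter)
  moreover have "((\<lambda>x::real. inverse x ^ n / exp (inverse x)) \<longlongrightarrow> 0) (at_right 0)"
    by (rule filterlim_compose[OF tendsto_power_div_exp_0 filterlim_inverse_at_top_right])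
  then have "(flat_fun n \<longlongrightarrow> 0) (at_right 0)"
    by (rule Lim_transform_eventually)
      (auto simp: flat_fun_def eventually_at_filter exp_minus field_simps)
  ultimately show ?thesis
    by (simp add: filterlim_split_at_real)
qed

text \<open>The index \<open>n\<close> exists for this formula: differentiating
  \<open>exp (- 1 / x)\<close> produces powers of \<open>1 / x\<close>, and allowing them from the
  start closes the family under derivatives up to linear combinations. At 0 the difference quotient
  of \<open>flat_fun n\<close> is \<open>flat_fun (Suc n)\<close>, which tends to 0.\<close>

lemma flat_fun_has_derivative:
  "(flat_fun n has_real_derivative flat_fun (n + 2) x - n * flat_fun (Suc n) x) (at x)"
proof (cases x "0 :: real" rule: linorder_cases)
  case less
  have "((\<lambda>_. 0) has_real_derivative flat_fun (n + 2) x - n * flat_fun (Suc n) x) (at x)"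
    using less by (simp add: flat_fun_def)
  then show ?thesis
    by (rule has_field_derivative_transform_within_open[of _ _ _ "{..<0}"])
      (use less in \<open>auto simp: flat_fun_def\<close>)
next
  case equal
  have "(flat_fun (Suc n) \<longlongrightarrow> 0) (at 0)"
    by (rule flat_fun_tendsto_0)
  then have "((\<lambda>h. flat_fun n h / h) \<longlongrightarrow> 0) (at 0)"
    by (rule Lim_transform_eventually) (auto simp: flat_fun_def eventually_at_filter)
  then show ?thesis
    using equal by (simp add: DERIV_def flat_fun_def)
next
  case greater
  have "((\<lambda>x. exp (- 1 / x) / x ^ n) has_real_derivative
      flat_fun (n + 2) x - n * flat_fun (Suc n) x) (at x)"
    \<comment> \<open>The power rule yields the exponent \<open>n - 1\<close>, truncated at
      \<open>n = 0\<close>; hence the case split.\<close>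
    using greater
    by (auto intro!: derivative_eq_intros simp: flat_fun_def)
      (cases n, auto simp: field_simps power2_eq_square)
  then show ?thesis
    by (rule has_field_derivative_transform_within_open[of _ _ _ "{0<..}"])
      (use greater in \<open>auto simp: flat_fun_def\<close>)
qed

text \<open>
  Unlike the class of all infinitely differentiable functions, this algebra is seen to be closed
  under \<^const>\<open>deriv\<close> by rule induction, without iterating the Leibniz rule.
\<close>

inductive_set bump_algebra :: "(real \<Rightarrow> real) set" where
  flat: "(\<lambda>t. flat_fun n (c * t + d)) \<in> bump_algebra"
| scale: "f \<in> bump_algebra \<Longrightarrow> (\<lambda>t. c * f t) \<in> bump_algebra"
| add: "f \<in> bump_algebra \<Longrightarrow> g \<in> bump_algebra \<Longrightarrow> (\<lambda>t. f t + g t) \<in> bump_algebra"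
| mult: "f \<in> bump_algebra \<Longrightarrow> g \<in> bump_algebra \<Longrightarrow> (\<lambda>t. f t * g t) \<in> bump_algebra"

text \<open>The chain rule on the generators, linearity, and the Leibniz rule on products all
  express the derivative through the four operations that generate the algebra.\<close>

lemma bump_algebra_has_derivative:
  assumes "f \<in> bump_algebra"
  shows "\<exists>f'\<in>bump_algebra. \<forall>x. (f has_real_derivative f' x) (at x)"
  using assms
proof induction
  case (flat n c d)
  \<comment> \<open>The algebra offers sums and scalar multiples, so the difference in the
    derivative of \<open>flat_fun\<close> is written with the factor
    \<open>- real n\<close>.\<close>
  let ?f' = "\<lambda>t. c * (flat_fun (n + 2) (c * t + d) + (- real n) * flat_fun (Suc n) (c * t + d))"
  have "?f' \<in> bump_algebra"
    by (intro bump_algebra.intros)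
  moreover have "((\<lambda>t. c * t + d) has_real_derivative c) (at x)" for x
    by (auto intro!: derivative_eq_intros)
  from DERIV_chain2[where f = "flat_fun n", OF flat_fun_has_derivative this]
  have "((\<lambda>t. flat_fun n (c * t + d)) has_real_derivative ?f' x) (at x)" for x
    by (rule DERIV_cong) (simp add: mult.commute)
  ultimately show ?case
    by (intro bexI[of _ ?f'] allI)
next
  case (scale f c)
  then obtain f' where "f' \<in> bump_algebra" "\<And>x. (f has_real_derivative f' x) (at x)"
    by blast
  then show ?case
    by (intro bexI[of _ "\<lambda>t. c * f' t"])
      (auto intro: bump_algebra.intros intro!: derivative_eq_intros)
next
  case (add f g)
  then obtain f' g' where "f' \<in> bump_algebra" "\<And>x. (f has_real_derivative f' x) (at x)"
     "g' \<in> bump_algebra" "\<And>x. (g has_real_derivative g' x) (at x)"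
    by blast
  then show ?case
    by (intro bexI[of _ "\<lambda>t. f' t + g' t"])
      (auto intro: bump_algebra.intros intro!: derivative_eq_intros)
next
  case (mult f g)
  then obtain f' g' where "f' \<in> bump_algebra" "\<And>x. (f has_real_derivative f' x) (at x)"
     "g' \<in> bump_algebra" "\<And>x. (g has_real_derivative g' x) (at x)"
    by blast
  with mult.hyps show ?case
    by (intro bexI[of _ "\<lambda>t. f' t * g t + g' t * f t"])
      (auto intro!: bump_algebra.intros derivative_eq_intros)
qed

lemma bump_algebra_deriv:
  assumes "f \<in> bump_algebra"
  shows "deriv f \<in> bump_algebra" "f differentiable (at x)"
proof -
  obtain f' where f': "f' \<in> bump_algebra" "\<And>x. (f has_real_derivative f' x) (at x)"
    using bump_algebra_has_derivative[OF assms] by blast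
  then have "deriv f = f'"
    by (intro ext DERIV_imp_deriv)
  then show "deriv f \<in> bump_algebra" "f differentiable (at x)"
    using f' by (auto simp: real_differentiable_def)
qed

lemma bump_algebra_deriv_funpow: "f \<in> bump_algebra \<Longrightarrow> (deriv ^^ n) f \<in> bump_algebra"
  by (induction n) (auto simp: bump_algebra_deriv)

section \<open>Product test functions supported in boxes\<close>

lemma deriv_mult_const: "deriv (\<lambda>s. f s * c) t = deriv f t * c"
  if "f differentiable (at t)" for f :: "real \<Rightarrow> real"
  using that
  by (intro DERIV_imp_deriv DERIV_cmult_right) (simp add: DERIV_deriv_iff_real_differentiable)

text \<open>Each partial derivative acts on one factor and sees the other as a constant. The
  differentiability needed at every stage is available because iterated derivatives stay in the
  algebra.\<close>

lemma partials_bump_product: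
  assumes "f \<in> bump_algebra" "g \<in> bump_algebra"
  shows "partials a b (\<lambda>(t, x). f t * g x) = (\<lambda>(t, x). (deriv ^^ a) f t * (deriv ^^ b) g x)"
proof -
  have x: "(partial_x ^^ b) (\<lambda>(t, x). f t * g x) = (\<lambda>(t, x). f t * (deriv ^^ b) g x)"
  proof (induction b)
    case (Suc b)
    have "(deriv ^^ b) g differentiable (at x)" for x
      using assms by (simp add: bump_algebra_deriv bump_algebra_deriv_funpow)
    from deriv_mult_const[OF this]
    have "partial_x (\<lambda>(t, x). f t * (deriv ^^ b) g x) = (\<lambda>(t, x). f t * (deriv ^^ Suc b) g x)"
      by (simp add: partial_x_def fun_eq_iff mult.commute)
    then show ?case
      by (simp add: Suc)
  qed simp
  have "(partial_t ^^ a) (\<lambda>(t, x). f t * (deriv ^^ b) g x) =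
      (\<lambda>(t, x). (deriv ^^ a) f t * (deriv ^^ b) g x)"
  proof (induction a)
    case (Suc a)
    have "(deriv ^^ a) f differentiable (at x)" for x
      using assms by (simp add: bump_algebra_deriv bump_algebra_deriv_funpow)
    from deriv_mult_const[OF this]
    have "partial_t (\<lambda>(t, x). (deriv ^^ a) f t * (deriv ^^ b) g x) =
        (\<lambda>(t, x). (deriv ^^ Suc a) f t * (deriv ^^ b) g x)"
      by (simp add: partial_t_def fun_eq_iff)
    then show ?case
      by (simp add: Suc)
  qed simp
  then show ?thesis
    by (simp add: partials_def x)
qed

text \<open>Every mixed partial derivative is again a product of two members of the algebra, so it
  suffices that such products are totally differentiable.\<close>

lemma smooth_bump_product:
  assumes "f \<in> bump_algebra" "g \<in> bump_algebra"
  shows "smooth (\<lambda>(t, x). f t * g x)"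
proof -
  have "(\<lambda>z. F (fst z) * G (snd z)) differentiable (at z)"
    if FG: "F \<in> bump_algebra" "G \<in> bump_algebra" for F G and z :: "real \<times> real"
  proof -
    obtain F' G' where "\<And>x. (F has_real_derivative F' x) (at x)"
      "\<And>x. (G has_real_derivative G' x) (at x)"
      using FG bump_algebra_has_derivative by blast
    then have "(F has_derivative (*) (F' (fst z))) (at (fst z))"
        "(G has_derivative (*) (G' (snd z))) (at (snd z))"
      by (auto simp: has_field_derivative_def)
    from has_derivative_mult[OF
        has_derivative_compose[OF has_derivative_fst[OF has_derivative_ident] this(1)]
        has_derivative_compose[OF has_derivative_snd[OF has_derivative_ident] this(2)]]
    show ?thesis
      unfolding differentiable_def by blast
  qed
  from this[OF bump_algebra_deriv_funpow[OF assms(1)] bump_algebra_deriv_funpow[OF assms(2)]]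
  show ?thesis
    unfolding smooth_def partials_bump_product[OF assms] case_prod_beta by blast
qed

text \<open>On the open interval this is
  \<open>exp (- 1 / (k * (t - a))) * exp (- 1 / (k * (b - t)))\<close>. Increasing \<open>k\<close>
  lifts the values towards 1 without enlarging the support. The arguments have the shape
  \<open>c * t + d\<close> so that the rule \<open>flat\<close> applies.\<close>

definition interval_bump :: "real \<Rightarrow> real \<Rightarrow> nat \<Rightarrow> real \<Rightarrow> real" where
  "interval_bump a b k t = flat_fun 0 (real k * t + (- real k * a)) *
    flat_fun 0 (- real k * t + real k * b)"

lemma interval_bump_in_bump_algebra: "interval_bump a b k \<in> bump_algebra"
  unfolding interval_bump_def[abs_def] by (intro bump_algebra.intros)

lemma interval_bump_bounds: "0 \<le> interval_bump a b k t" "interval_bump a b k t \<le> 1"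
proof -
  have "0 \<le> flat_fun 0 s" "flat_fun 0 s \<le> 1" for s
    by (auto simp: flat_fun_def)
  then show "0 \<le> interval_bump a b k t" "interval_bump a b k t \<le> 1"
    by (auto simp: interval_bump_def intro: mult_le_one)
qed

lemma interval_bump_eq_0:
  assumes "t \<notin> {a<..<b}"
  shows "interval_bump a b k t = 0"
proof -
  have "real k * (t - a) \<le> 0 \<or> real k * (b - t) \<le> 0"
    using assms by (auto simp: mult_le_0_iff)
  then show ?thesis
    by (auto simp: interval_bump_def flat_fun_def algebra_simps)
qed

lemma flat_fun_dilate_tendsto_1:
  assumes "s > 0"
  shows "(\<lambda>k. flat_fun 0 (real k * s)) \<longlonglongrightarrow> 1"
proof -
  have "(\<lambda>k. exp (- (1 / s * (1 / real k)))) \<longlonglongrightarrow> exp (- (1 / s * 0))"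
    by (intro tendsto_intros lim_1_over_n)
  then have "(\<lambda>k. exp (- (1 / s * (1 / real k)))) \<longlonglongrightarrow> 1"
    by simp
  \<comment> \<open>The two sequences differ at \<open>k = 0\<close>: division by zero makes the
    exponential 1 there, while \<open>flat_fun 0 0\<close> is 0. They agree for
    \<open>k > 0\<close>.\<close>
  then show ?thesis
    by (rule Lim_transform_eventually)
      (use assms in \<open>auto intro!: eventually_mono[OF eventually_gt_at_top[of 0]] simp: flat_fun_def\<close>)
qed

lemma interval_bump_tendsto_indicator:
  "(\<lambda>k. interval_bump a b k t) \<longlonglongrightarrow> indicator {a<..<b} t"
proof (cases "t \<in> {a<..<b}")
  case True
  then have "(\<lambda>k. flat_fun 0 (real k * (t - a)) * flat_fun 0 (real k * (b - t))) \<longlonglongrightarrow> 1 * 1"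
    by (intro tendsto_mult flat_fun_dilate_tendsto_1) auto
  then show ?thesis
    using True by (simp add: interval_bump_def algebra_simps)
qed (simp add: interval_bump_eq_0)

lemma box_prod_real: "box (a, c) (b, d) = {a<..<b} \<times> {c<..<(d::real)}" for a b :: real
  by (auto simp: mem_box Basis_prod_def)

lemma test_function_box:
  assumes "cbox (a, c) (b, d) \<subseteq> \<Omega>"
  shows "test_function \<Omega> (\<lambda>(t, x). interval_bump a b k t * interval_bump c d k x)"
  unfolding test_function_def
proof (intro conjI exI allI impI)
  show "smooth (\<lambda>(t, x). interval_bump a b k t * interval_bump c d k x)"
    by (intro smooth_bump_product interval_bump_in_bump_algebra)
  fix z :: "real \<times> real"
  \<comment> \<open>The closed box serves as the compact set; the product already vanishes outside
    the open box.\<close>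
  assume "z \<notin> cbox (a, c) (b, d)"
  then have "z \<notin> {a<..<b} \<times> {c<..<d}"
    using box_subset_cbox by (auto simp flip: box_prod_real)
  then show "(case z of (t, x) \<Rightarrow> interval_bump a b k t * interval_bump c d k x) = 0"
    by (cases z) (auto simp: interval_bump_eq_0)
qed (use assms in auto)

section \<open>The fundamental lemma of the calculus of variations\<close>

lemma smooth_partials_continuous_on: "smooth \<phi> \<Longrightarrow> continuous_on S (partials a b \<phi>)"
  unfolding smooth_def
  by (intro differentiable_imp_continuous_on)
    (auto simp: differentiable_on_def simp del: split_paired_All intro: differentiable_at_withinI)

text \<open>The product bumps are test functions with values in [0, 1] that converge pointwise to
  the indicator of the open box. Dominated convergence with majorant \<open>\<bar>g\<bar>\<close>
  carries the vanishing integrals to the limit.\<close>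

lemma box_integral_eq_0:
  assumes "open \<Omega>" "integrable (lebesgue_on \<Omega>) g"
    and test: "\<And>\<phi>. test_function \<Omega> \<phi> \<Longrightarrow> (LINT z|lebesgue_on \<Omega>. g z * \<phi> z) = 0"
    and "cbox p p' \<subseteq> \<Omega>"
  shows "(LINT z|lebesgue_on \<Omega>. g z * indicator (box p p') z) = 0"
proof -
  obtain a c b d where p: "p = (a, c)" "p' = (b, d)"
    by fastforce
  define \<phi> where "\<phi> = (\<lambda>k (t, x). interval_bump a b k t * interval_bump c d k x)"
  have [measurable]: "\<phi> k \<in> borel_measurable (lebesgue_on \<Omega>)" for k
  proof -
    have "smooth (\<phi> k)"
      unfolding \<phi>_def by (intro smooth_bump_product interval_bump_in_bump_algebra)
    then have "continuous_on \<Omega> (\<phi> k)"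
      using smooth_partials_continuous_on[of "\<phi> k" \<Omega> 0 0] by (simp add: partials_def)
    then show ?thesis
      using \<open>open \<Omega>\<close> by (intro continuous_imp_measurable_on_sets_lebesgue) auto
  qed
  have [measurable]: "g \<in> borel_measurable (lebesgue_on \<Omega>)"
    using assms by auto
  have [measurable]: "box p p' \<inter> \<Omega> \<in> sets (lebesgue_on \<Omega>)"
    using \<open>open \<Omega>\<close> by (auto simp: sets_restrict_space)
  have "(\<lambda>k. LINT z|lebesgue_on \<Omega>. g z * \<phi> k z) \<longlonglongrightarrow>
      (LINT z|lebesgue_on \<Omega>. g z * indicator (box p p') z)"
  proof (rule integral_dominated_convergence[where w = "\<lambda>z. \<bar>g z\<bar>"])
    show "integrable (lebesgue_on \<Omega>) (\<lambda>z. \<bar>g z\<bar>)"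
      using assms by auto
    \<comment> \<open>Measurable sets of \<open>lebesgue_on \<Omega>\<close> lie inside
      \<open>\<Omega>\<close>, so the box is first cut down to \<open>\<Omega>\<close>; on
      \<open>\<Omega>\<close> both indicators agree.\<close>
    have "(\<lambda>z. g z * indicator (box p p' \<inter> \<Omega>) z) \<in> borel_measurable (lebesgue_on \<Omega>)"
      by measurable
    then show "(\<lambda>z. g z * indicator (box p p') z) \<in> borel_measurable (lebesgue_on \<Omega>)"
      by (rule measurable_cong[THEN iffD1, rotated]) (auto simp: indicator_def)
    have "(\<lambda>k. \<phi> k z) \<longlonglongrightarrow> indicator (box p p') z" for z
    proof -
      have "(\<lambda>k. interval_bump a b k (fst z) * interval_bump c d k (snd z)) \<longlonglongrightarrow>
          indicator {a<..<b} (fst z) * indicator {c<..<d} (snd z)"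
        by (intro tendsto_mult interval_bump_tendsto_indicator)
      then show ?thesis
        by (simp add: \<phi>_def p box_prod_real case_prod_beta indicator_times)
    qed
    then show "AE z in lebesgue_on \<Omega>. (\<lambda>k. g z * \<phi> k z) \<longlonglongrightarrow> g z * indicator (box p p') z"
      by (intro AE_I2 tendsto_mult tendsto_const)
    have "\<bar>\<phi> k z\<bar> \<le> 1" for k z
      by (auto simp: \<phi>_def abs_mult interval_bump_bounds split: prod.split intro!: mult_le_one)
    then show "AE z in lebesgue_on \<Omega>. norm (g z * \<phi> k z) \<le> \<bar>g z\<bar>" for k
      by (intro AE_I2) (auto simp: abs_mult mult_left_le)
  qed auto
  moreover have "(LINT z|lebesgue_on \<Omega>. g z * \<phi> k z) = 0" for k
    using assms(4) unfolding \<phi>_def p by (intro test test_function_box)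
  ultimately show ?thesis
    by (simp add: LIMSEQ_const_iff)
qed

text \<open>Fix a box \<open>Q\<close> whose closed box lies in \<open>\<Omega>\<close>. The Borel
  sets \<open>A\<close> for which \<open>g\<close> integrates to 0 over \<open>A \<inter> Q\<close>
  form a Dynkin system containing the boxes, hence are all Borel sets. Lebesgue sets follow up to
  null sets, so \<open>g\<close> vanishes almost everywhere on \<open>Q\<close>, and countably many
  such \<open>Q\<close> cover \<open>\<Omega>\<close>.\<close>

lemma AE_eq_0_if_box_integrals_eq_0:
  fixes g :: "'a::euclidean_space \<Rightarrow> real"
  assumes "open \<Omega>" "bounded \<Omega>" "integrable (lebesgue_on \<Omega>) g"
    and box: "\<And>p p'. cbox p p' \<subseteq> \<Omega> \<Longrightarrow> (LINT z|lebesgue_on \<Omega>. g z * indicator (box p p') z) = 0"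
  shows "AE z in lebesgue_on \<Omega>. g z = 0"
proof -
  let ?M = "lebesgue_on \<Omega>"
  interpret finite_measure ?M
    using assms by (intro finite_measure_lebesgue_on lmeasurable_open)
  have \<Omega>: "\<Omega> \<in> sets lebesgue"
    using \<open>open \<Omega>\<close> by auto
  have ind_meas: "(\<lambda>z. indicator A z :: real) \<in> borel_measurable ?M" if "A \<in> sets borel" for A
    using that by (intro measurable_restrict_space1 measurable_completion) auto
  have int: "integrable ?M (\<lambda>z. g z * indicator A z)" if "A \<in> sets borel" for A
    using assms(3)
    by (rule Bochner_Integration.integrable_bound)
      (use assms(3) ind_meas[OF that] in \<open>auto simp: indicator_def intro!: borel_measurable_times\<close>)
  have local: "AE z in ?M. z \<in> box p p' \<longrightarrow> g z = 0" if Q: "cbox p p' \<subseteq> \<Omega>" for p p'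
  proof -
    define Q where "Q = box p p'"
    have Qb: "Q \<in> sets borel"
      by (simp add: Q_def)
    have borel_0: "(LINT z|?M. g z * indicator (A \<inter> Q) z) = 0" if "A \<in> sets borel" for A
    proof -
      have "Int_stable (range (\<lambda>(a, b). box a b :: 'a set))"
        by (auto simp: Int_stable_def box_Int_box)
      moreover have "range (\<lambda>(a, b). box a b :: 'a set) \<subseteq> Pow UNIV"
        by auto
      moreover have "A \<in> sigma_sets UNIV (range (\<lambda>(a, b). box a b))"
        using that unfolding borel_eq_box by simp
      ultimately show ?thesis
      proof (induction rule: sigma_sets_induct_disjoint)
        case (basic A)
        then obtain a b where A: "A = box a b"
          by auto
        show ?case
        proof (cases "box a b \<inter> box p p' = {}")
          case False
          \<comment> \<open>The intersection of two boxes is a box, and its closed box lies in that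
            of \<open>Q\<close>, hence in \<open>\<Omega>\<close>, so the hypothesis applies to
            it.\<close>
          let ?l = "\<Sum>i\<in>Basis. max (a \<bullet> i) (p \<bullet> i) *\<^sub>R i"
          let ?u = "\<Sum>i\<in>Basis. min (b \<bullet> i) (p' \<bullet> i) *\<^sub>R i"
          have "cbox ?l ?u = cbox a b \<inter> cbox p p'"
            by (simp add: Int_interval)
          then have "cbox ?l ?u \<subseteq> \<Omega>"
            using Q by auto
          then show ?thesis
            using box by (simp add: A Q_def box_Int_box)
        qed (simp add: A Q_def)
      next
        case empty
        then show ?case by simp
      next
        \<comment> \<open>Here the restriction to \<open>Q\<close> pays off: the integral over
          \<open>Q\<close> vanishes by hypothesis, whereas nothing of the kind is assumed directly
          for \<open>\<Omega>\<close>.\<close>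
        case (compl A)
        then have A: "A \<in> sets borel"
          unfolding borel_eq_box by simp
        have "(LINT z|?M. g z * indicator ((UNIV - A) \<inter> Q) z) =
            (LINT z|?M. g z * indicator Q z - g z * indicator (A \<inter> Q) z)"
          by (rule Bochner_Integration.integral_cong) (auto simp: indicator_def)
        also have "\<dots> = (LINT z|?M. g z * indicator Q z) - (LINT z|?M. g z * indicator (A \<inter> Q) z)"
          using A Qb by (intro Bochner_Integration.integral_diff int) auto
        also have "\<dots> = 0"
          using compl box[OF Q] by (simp add: Q_def)
        finally show ?case .
      next
        case (union A)
        then have A: "A i \<in> sets borel" for i
          unfolding borel_eq_box by auto
        \<comment> \<open>Countable additivity is stated for measurable sets of the restricted
          measure, so each set is intersected with \<open>\<Omega>\<close>; this does not change the
          integral.\<close>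
        have eq: "(LINT z:S \<inter> \<Omega>|?M. g z * indicator Q z) = (LINT z|?M. g z * indicator (S \<inter> Q) z)" for S
          unfolding set_lebesgue_integral_def
          by (rule Bochner_Integration.integral_cong) (auto simp: indicator_def)
        have sets: "S \<inter> \<Omega> \<in> sets ?M" if "S \<in> sets borel" for S
          using that by (auto simp: sets_restrict_space)
        have "(LINT z:(\<Union>i. A i \<inter> \<Omega>)|?M. g z * indicator Q z) =
            (\<Sum>i. LINT z:A i \<inter> \<Omega>|?M. g z * indicator Q z)"
        proof (rule lebesgue_integral_countable_add)
          show "A i \<inter> \<Omega> \<in> sets ?M" for i
            using sets[OF A] .
          show "A i \<inter> \<Omega> \<inter> (A j \<inter> \<Omega>) = {}" if "i \<noteq> j" for i j
            using union(1) that by (auto simp: disjoint_family_on_def)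
          show "set_integrable ?M (\<Union>i. A i \<inter> \<Omega>) (\<lambda>z. g z * indicator Q z)"
            unfolding set_integrable_def
            using sets[OF A]
            by (intro integrable_mult_indicator int[OF Qb] sets.countable_nat_UN image_subsetI)
        qed
        also have "\<dots> = 0"
          by (simp add: eq union)
        finally show ?case
          using eq[of "\<Union>i. A i"] by simp
      qed
    qed
    have "AE z in ?M. g z * indicator Q z = 0"
    proof (rule density_zero)
      show "integrable ?M (\<lambda>z. g z * indicator Q z)"
        by (rule int[OF Qb])
      fix A assume "A \<in> sets ?M"
      then have "A \<in> sets lebesgue"
        using \<Omega> by (auto simp: sets_restrict_space)
      \<comment> \<open>A Lebesgue set is a countable union of closed sets up to a null set, which
        reduces it to the Borel case.\<close>
      then obtain C T where C: "fsigma C" "T \<in> null_sets lebesgue" "C \<union> T = A"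
        using lebesgue_set_almost_fsigma by metis
      have "C \<in> sets borel"
        using \<open>fsigma C\<close> unfolding fsigma_Union_compact
        by (auto simp: image_subset_iff intro!: sets.countable_nat_UN intro: borel_compact)
      have "set_lebesgue_integral ?M A (\<lambda>z. g z * indicator Q z) = (LINT z|?M. g z * indicator (C \<inter> Q) z)"
        unfolding set_lebesgue_integral_def
      proof (rule integral_cong_AE)
        have "AE z in lebesgue. z \<notin> T"
          using C by (intro AE_not_in)
        then have "AE z in ?M. z \<notin> T"
          using \<Omega> by (auto simp: AE_restrict_space_iff elim: eventually_mono)
        then show "AE z in ?M. indicator A z *\<^sub>R (g z * indicator Q z) = g z * indicator (C \<inter> Q) z"
          by eventually_elim (use C in \<open>auto simp: indicator_def\<close>)
        show "(\<lambda>z. indicator A z *\<^sub>R (g z * indicator Q z)) \<in> borel_measurable ?M"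
          using \<open>A \<in> sets ?M\<close> int[OF Qb] by (intro borel_measurable_scaleR) auto
        show "(\<lambda>z. g z * indicator (C \<inter> Q) z) \<in> borel_measurable ?M"
          using int[of "C \<inter> Q"] Qb \<open>C \<in> sets borel\<close> by auto
      qed
      then show "set_lebesgue_integral ?M A (\<lambda>z. g z * indicator Q z) = 0"
        using borel_0[OF \<open>C \<in> sets borel\<close>] by simp
    qed
    then show ?thesis
      by eventually_elim (auto simp: Q_def indicator_def)
  qed
  \<comment> \<open>The admissible boxes form an uncountable family; a countable subfamily with the
    same union allows the exceptional null sets to be collected.\<close>
  obtain F where F: "F \<subseteq> {box p p' | p p'. cbox p p' \<subseteq> \<Omega>}" "countable F"
      "\<Union>F = \<Union>{box p p' | p p'. cbox p p' \<subseteq> \<Omega>}"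
    by (rule Lindelof[of "{box p p' | p p'. cbox p p' \<subseteq> \<Omega>}"]) auto
  have "\<forall>S\<in>F. AE z in ?M. z \<in> S \<longrightarrow> g z = 0"
    using F(1) local by auto
  then have ae: "AE z in ?M. \<forall>S\<in>F. z \<in> S \<longrightarrow> g z = 0"
    unfolding AE_ball_countable[OF F(2)] .
  have cover: "z \<in> \<Union>F" if "z \<in> \<Omega>" for z
  proof -
    obtain e where "e > 0" "cball z e \<subseteq> \<Omega>"
      using \<open>open \<Omega>\<close> \<open>z \<in> \<Omega>\<close> open_contains_cball by blast
    moreover obtain p p' where p: "z \<in> box p p'" "box p p' \<subseteq> ball z e"
      using rational_boxes[OF \<open>e > 0\<close>, of z] by metis
    \<comment> \<open>The closure of an open box is the closed box only when the open box is
      nonempty; here it contains \<open>z\<close>.\<close>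
    moreover have "cbox p p' \<subseteq> cball z e"
    proof -
      have "box p p' \<noteq> {}"
        using p(1) by blast
      then show ?thesis
        using closure_mono[OF p(2)] \<open>e > 0\<close> by (simp add: closure_box)
    qed
    ultimately show ?thesis
      unfolding F(3) by blast
  qed
  have "AE z in ?M. z \<in> \<Omega>"
    by (auto intro: AE_I2)
  with ae show ?thesis
    by eventually_elim (use cover in blast)
qed

section \<open>Uniqueness and linearity of weak derivatives\<close>

lemma smooth_partials_bounded:
  assumes "smooth \<phi>" "bounded \<Omega>"
  obtains K where "\<And>z. z \<in> \<Omega> \<Longrightarrow> \<bar>partials a b \<phi> z\<bar> \<le> K"
proof -
  have "compact (partials a b \<phi> ` closure \<Omega>)"
    using assms by (intro compact_continuous_image smooth_partials_continuous_on) auto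
  then obtain K where "\<forall>y\<in>partials a b \<phi> ` closure \<Omega>. norm y \<le> K"
    using compact_imp_bounded bounded_iff by metis
  with that closure_subset show ?thesis
    by (metis image_eqI real_norm_def subsetD)
qed

text \<open>A bounded open set has finite measure, so \<open>1 + (norm (w z))\<^sup>2\<close> is
  integrable, and it dominates \<open>w\<close>.\<close>

lemma L2_integrable:
  fixes w :: "'a::euclidean_space \<Rightarrow> real"
  assumes "open \<Omega>" "bounded \<Omega>" "w \<in> L2 (lebesgue_on \<Omega>)"
  shows "integrable (lebesgue_on \<Omega>) w"
proof -
  have "finite_measure (lebesgue_on \<Omega>)"
    using assms by (intro finite_measure_lebesgue_on lmeasurable_open)
  then have "integrable (lebesgue_on \<Omega>) (\<lambda>z. 1 + (norm (w z))\<^sup>2)"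
    using assms by (auto simp: L2_def finite_measure.integrable_const)
  moreover have "norm x \<le> norm (1 + (norm x)\<^sup>2)" for x :: real
    using zero_le_power2[of "\<bar>x\<bar> - 1"] zero_le_power2[of x] by (simp add: power2_diff)
  ultimately show ?thesis
    using assms(3) by (elim Bochner_Integration.integrable_bound) (auto simp: L2_def)
qed

lemma L2_diff:
  assumes "v \<in> L2 M" "w \<in> L2 M"
  shows "(\<lambda>z. v z - w z) \<in> L2 M"
proof -
  have "norm ((norm (x - y))\<^sup>2) \<le> norm (2 * (norm x)\<^sup>2 + 2 * (norm y)\<^sup>2)" for x y :: 'b
  proof -
    have "0 \<le> (norm (x + y))\<^sup>2"
      by simp
    then have "(norm (x - y))\<^sup>2 \<le> 2 * (norm x)\<^sup>2 + 2 * (norm y)\<^sup>2"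
      by (simp add: power2_norm_eq_inner inner_simps inner_commute)
    then show ?thesis
      by simp
  qed
  moreover have "integrable M (\<lambda>z. 2 * (norm (v z))\<^sup>2 + 2 * (norm (w z))\<^sup>2)"
    using assms by (auto simp: L2_def)
  ultimately have "integrable M (\<lambda>z. (norm (v z - w z))\<^sup>2)"
    using assms by (elim Bochner_Integration.integrable_bound) (auto simp: L2_def)
  then show ?thesis
    using assms by (auto simp: L2_def)
qed

lemma L2_times_smooth_partials_integrable:
  assumes "open \<Omega>" "bounded \<Omega>" "w \<in> L2 (lebesgue_on \<Omega>)" "smooth \<phi>"
  shows "integrable (lebesgue_on \<Omega>) (\<lambda>z. w z * partials a b \<phi> z)"
proof -
  obtain K where K: "\<And>z. z \<in> \<Omega> \<Longrightarrow> \<bar>partials a b \<phi> z\<bar> \<le> K"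
    using smooth_partials_bounded assms by blast
  have "integrable (lebesgue_on \<Omega>) (\<lambda>z. K * w z)"
    using L2_integrable assms by blast
  moreover have "partials a b \<phi> \<in> borel_measurable (lebesgue_on \<Omega>)"
    using assms by (intro continuous_imp_measurable_on_sets_lebesgue smooth_partials_continuous_on) auto
  moreover have "norm (w z * partials a b \<phi> z) \<le> norm (K * w z)" if "z \<in> \<Omega>" for z
    using mult_left_mono[OF order_trans[OF K[OF that] abs_ge_self], of "\<bar>w z\<bar>"]
    by (simp add: abs_mult mult.commute)
  ultimately show ?thesis
    using assms(3)
    by (elim Bochner_Integration.integrable_bound) (auto simp: L2_def simp del: split_paired_All)
qed

text \<open>The defining identity is linear in \<open>w\<close> and \<open>g\<close>; splitting the
  Bochner integrals of differences requires each term to be integrable, which boundedness of the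
  test function and its derivatives on \<open>\<Omega>\<close> provides.\<close>

lemma has_weak_partials_diff:
  assumes "open \<Omega>" "bounded \<Omega>"
    and "has_weak_partials \<Omega> a b w g" "has_weak_partials \<Omega> a b w' g'"
  shows "has_weak_partials \<Omega> a b (\<lambda>z. w z - w' z) (\<lambda>z. g z - g' z)"
proof -
  have L2: "w \<in> L2 (lebesgue_on \<Omega>)" "w' \<in> L2 (lebesgue_on \<Omega>)"
      "g \<in> L2 (lebesgue_on \<Omega>)" "g' \<in> L2 (lebesgue_on \<Omega>)"
    using assms by (auto simp: has_weak_partials_def)
  have "(LINT z|lebesgue_on \<Omega>. (w z - w' z) * partials a b \<phi> z) =
      (-1) ^ (a + b) * (LINT z|lebesgue_on \<Omega>. (g z - g' z) * \<phi> z)"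
    if "test_function \<Omega> \<phi>" for \<phi>
  proof -
    have "smooth \<phi>"
      using that by (simp add: test_function_def)
    note int = L2_times_smooth_partials_integrable[OF assms(1,2) _ this]
    \<comment> \<open>The test function itself is its own derivative of order (0, 0).\<close>
    note int0 = int[where a = 0 and b = 0, simplified partials_def, simplified]
    show ?thesis
      using assms(3,4) that int[OF L2(1)] int[OF L2(2)] int0[OF L2(3)] int0[OF L2(4)]
      by (simp add: has_weak_partials_def left_diff_distrib right_diff_distrib)
  qed
  then show ?thesis
    by (simp add: has_weak_partials_def L2_diff L2)
qed

text \<open>The difference of two candidates is a weak derivative of the zero function, so it
  integrates to 0 against every test function and the fundamental lemma applies.\<close>

lemma has_weak_partials_unique:
  assumes "open \<Omega>" "bounded \<Omega>"
    and "has_weak_partials \<Omega> a b w g" "has_weak_partials \<Omega> a b w g'"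
  shows "AE z in lebesgue_on \<Omega>. g z = g' z"
proof -
  have diff: "has_weak_partials \<Omega> a b (\<lambda>z. w z - w z) (\<lambda>z. g z - g' z)"
    using assms by (intro has_weak_partials_diff)
  have int: "integrable (lebesgue_on \<Omega>) (\<lambda>z. g z - g' z)"
    using diff assms by (intro L2_integrable) (auto simp: has_weak_partials_def)
  have "(LINT z|lebesgue_on \<Omega>. (g z - g' z) * \<phi> z) = 0" if "test_function \<Omega> \<phi>" for \<phi>
    using diff that by (simp add: has_weak_partials_def)
  with int have "AE z in lebesgue_on \<Omega>. g z - g' z = 0"
    using assms by (intro AE_eq_0_if_box_integrals_eq_0 box_integral_eq_0)
  then show ?thesis
    by simp
qed

lemma has_weak_partials_weak_partials:
  "\<exists>g. has_weak_partials \<Omega> a b w g \<Longrightarrow> has_weak_partials \<Omega> a b w (weak_partials \<Omega> a b w)"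
  unfolding weak_partials_def using someI_ex[of "has_weak_partials \<Omega> a b w"] .

text \<open>The representatives of the three derivatives are chosen independently. Both sides are
  weak derivatives of the same difference, so uniqueness identifies them almost everywhere.\<close>

lemma weak_partials_diff:
  assumes "open \<Omega>" "bounded \<Omega>"
    and "\<exists>g. has_weak_partials \<Omega> a b w g" "\<exists>g. has_weak_partials \<Omega> a b w' g"
  shows "AE z in lebesgue_on \<Omega>.
      weak_partials \<Omega> a b (\<lambda>z. w z - w' z) z = weak_partials \<Omega> a b w z - weak_partials \<Omega> a b w' z"
proof (rule has_weak_partials_unique[OF assms(1,2)])
  show *: "has_weak_partials \<Omega> a b (\<lambda>z. w z - w' z)
      (\<lambda>z. weak_partials \<Omega> a b w z - weak_partials \<Omega> a b w' z)"
    using assms by (intro has_weak_partials_diff has_weak_partials_weak_partials)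
  then show "has_weak_partials \<Omega> a b (\<lambda>z. w z - w' z) (weak_partials \<Omega> a b (\<lambda>z. w z - w' z))"
    by (intro has_weak_partials_weak_partials exI)
qed

lemma sobolev_1_has_weak_partials:
  "w \<in> sobolev \<Omega> 1 \<Longrightarrow> a + b \<le> 1 \<Longrightarrow> \<exists>g. has_weak_partials \<Omega> a b w g"
  by (simp add: sobolev_def)

lemma sobolev_1_weak_partials_L2:
  assumes "w \<in> sobolev \<Omega> 1" "a + b \<le> 1"
  shows "weak_partials \<Omega> a b w \<in> L2 (lebesgue_on \<Omega>)"
  using has_weak_partials_weak_partials[OF sobolev_1_has_weak_partials[OF assms]]
  by (simp add: has_weak_partials_def)

text \<open>The approximation hypothesis for \<open>\<psi>\<close> is phrased with
  \<open>grad\<close>, while the functional contains \<open>grad_perp\<close>; this converts one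
  into the other.\<close>

lemma norm_grad_perp: "norm (grad_perp \<Omega> v z) = norm (grad \<Omega> v z)"
  by (simp add: grad_def grad_perp_def norm_Pair add.commute)

lemma sobolev_1_diff:
  assumes "open \<Omega>" "bounded \<Omega>" "w \<in> sobolev \<Omega> 1" "w' \<in> sobolev \<Omega> 1"
  shows "(\<lambda>z. w z - w' z) \<in> sobolev \<Omega> 1"
proof -
  have "\<exists>g. has_weak_partials \<Omega> a b (\<lambda>z. w z - w' z) g" if "a + b \<le> 1" for a b
    using sobolev_1_has_weak_partials[OF assms(3) that] sobolev_1_has_weak_partials[OF assms(4) that]
      has_weak_partials_diff[OF assms(1,2)] by meson
  then show ?thesis
    by (simp add: sobolev_def)
qed

lemma norm_grad_power2_integrable:
  assumes "w \<in> sobolev \<Omega> 1"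
  shows "integrable (lebesgue_on \<Omega>) (\<lambda>z. (norm (grad \<Omega> w z))\<^sup>2)"
  using sobolev_1_weak_partials_L2[OF assms, of 1 0] sobolev_1_weak_partials_L2[OF assms, of 0 1]
  by (auto simp: grad_def norm_Pair L2_def)

lemma grad_diff:
  assumes "open \<Omega>" "bounded \<Omega>" "w \<in> sobolev \<Omega> 1" "w' \<in> sobolev \<Omega> 1"
  shows "AE z in lebesgue_on \<Omega>. grad \<Omega> (\<lambda>z. w z - w' z) z = grad \<Omega> w z - grad \<Omega> w' z"
    and "AE z in lebesgue_on \<Omega>.
      grad_perp \<Omega> (\<lambda>z. w z - w' z) z = grad_perp \<Omega> w z - grad_perp \<Omega> w' z"
proof -
  have *: "AE z in lebesgue_on \<Omega>.
      weak_partials \<Omega> a b (\<lambda>z. w z - w' z) z = weak_partials \<Omega> a b w z - weak_partials \<Omega> a b w' z"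
    if "a + b \<le> 1" for a b
    using assms that by (intro weak_partials_diff sobolev_1_has_weak_partials)
  have "AE z in lebesgue_on \<Omega>.
      grad \<Omega> (\<lambda>z. w z - w' z) z = grad \<Omega> w z - grad \<Omega> w' z \<and>
      grad_perp \<Omega> (\<lambda>z. w z - w' z) z = grad_perp \<Omega> w z - grad_perp \<Omega> w' z"
    using *[of 1 0, simplified] *[of 0 1, simplified]
    by eventually_elim (simp add: grad_def grad_perp_def)
  then show "AE z in lebesgue_on \<Omega>. grad \<Omega> (\<lambda>z. w z - w' z) z = grad \<Omega> w z - grad \<Omega> w' z"
    and "AE z in lebesgue_on \<Omega>.
      grad_perp \<Omega> (\<lambda>z. w z - w' z) z = grad_perp \<Omega> w z - grad_perp \<Omega> w' z"
    by auto
qed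

section \<open>Bounds for the least-squares functional\<close>

lemma AE_le_Linf_norm:
  assumes "Linf_norm M v \<le> ereal B"
  shows "AE z in M. \<bar>v z\<bar> \<le> B"
  using esssup_AE[of "\<lambda>z. ereal \<bar>v z\<bar>" M]
proof eventually_elim
  case (elim z)
  then have "ereal \<bar>v z\<bar> \<le> ereal B"
    using assms unfolding Linf_norm_def by (rule order_trans)
  then show ?case
    by simp
qed

lemma L2_norm_power2: "(L2_norm M v)\<^sup>2 = (LINT z|M. (norm (v z))\<^sup>2)"
  by (simp add: L2_norm_def)

text \<open>The right side minus the left side is the sum of the squared norms of the pairwise
  differences.\<close>

lemma norm_add3_power2_le:
  fixes x y z :: "'a::real_inner"
  shows "(norm (x + y + z))\<^sup>2 \<le> 3 * ((norm x)\<^sup>2 + (norm y)\<^sup>2 + (norm z)\<^sup>2)"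
proof -
  have "0 \<le> (norm (x - y))\<^sup>2 + (norm (x - z))\<^sup>2 + (norm (y - z))\<^sup>2"
    by simp
  then show ?thesis
    unfolding power2_norm_eq_inner
    by (simp add: inner_simps inner_commute)
qed

text \<open>The factor 3 comes from squaring a sum of three terms. The term in \<open>p - q\<close>
  has factor 4 because it also forms the second summand of \<open>LS_F\<close>.\<close>

lemma LS_F_le:
  assumes "open \<Omega>" "bounded \<Omega>"
    and sobolev: "p \<in> sobolev \<Omega> 1" "\<mu> \<in> sobolev \<Omega> 1" "q \<in> sobolev \<Omega> 1" "\<psi> \<in> sobolev \<Omega> 1"
    and meas: "v \<in> borel_measurable (lebesgue_on \<Omega>)" "w \<in> borel_measurable (lebesgue_on \<Omega>)"
    and bound: "AE z in lebesgue_on \<Omega>. \<bar>v z\<bar> \<le> B" "AE z in lebesgue_on \<Omega>. \<bar>w z\<bar> \<le> B"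
    and lip: "\<And>a b. \<bar>a\<bar> \<le> B \<Longrightarrow> \<bar>b\<bar> \<le> B \<Longrightarrow> (norm (f a - f b))\<^sup>2 \<le> L * (a - b)\<^sup>2"
    and decomposition: "AE z in lebesgue_on \<Omega>. f (w z) = grad \<Omega> q z + grad_perp \<Omega> \<psi> z"
  shows "LS_F \<Omega> f v p \<mu> q \<le>
      3 * L * (L2_norm (lebesgue_on \<Omega>) (\<lambda>z. v z - w z))\<^sup>2 +
      4 * (L2_norm (lebesgue_on \<Omega>) (grad \<Omega> (\<lambda>z. p z - q z)))\<^sup>2 +
      3 * (L2_norm (lebesgue_on \<Omega>) (grad \<Omega> (\<lambda>z. \<mu> z - \<psi> z)))\<^sup>2"
proof -
  let ?M = "lebesgue_on \<Omega>"
  let ?P = "grad \<Omega> (\<lambda>z. p z - q z)" and ?N = "grad \<Omega> (\<lambda>z. \<mu> z - \<psi> z)"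
  let ?N' = "grad_perp \<Omega> (\<lambda>z. \<mu> z - \<psi> z)"
  note diff_p = grad_diff[OF assms(1,2) sobolev(1,3)]
  note diff_\<mu> = grad_diff[OF assms(1,2) sobolev(2,4)]
  have fin: "finite_measure ?M"
    using assms by (intro finite_measure_lebesgue_on lmeasurable_open)
  have int_vw: "integrable ?M (\<lambda>z. (norm (v z - w z))\<^sup>2)"
  proof (rule finite_measure.integrable_const_bound[OF fin])
    show "AE z in ?M. norm ((norm (v z - w z))\<^sup>2) \<le> (2 * B)\<^sup>2"
      using bound
    proof eventually_elim
      case (elim z)
      then have "\<bar>v z - w z\<bar> \<le> 2 * B"
        by linarith
      then show ?case
        using power_mono[of "\<bar>v z - w z\<bar>" "2 * B" 2] by simp
    qed
  qed (use meas in simp)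
  have int_P: "integrable ?M (\<lambda>z. (norm (?P z))\<^sup>2)" and int_N: "integrable ?M (\<lambda>z. (norm (?N z))\<^sup>2)"
    using assms by (auto intro!: norm_grad_power2_integrable sobolev_1_diff)
  have int: "integrable ?M (\<lambda>z. 3 * L * (norm (v z - w z))\<^sup>2 + 3 * (norm (?P z))\<^sup>2 + 3 * (norm (?N z))\<^sup>2)"
    using int_vw int_P int_N by simp
  have le: "AE z in ?M. (norm (f (v z) - grad \<Omega> p z - grad_perp \<Omega> \<mu> z))\<^sup>2 \<le>
      3 * L * (norm (v z - w z))\<^sup>2 + 3 * (norm (?P z))\<^sup>2 + 3 * (norm (?N z))\<^sup>2"
    using bound decomposition diff_p(1) diff_\<mu>(2)
  proof eventually_elim
    case (elim z)
    \<comment> \<open>Subtracting \<open>f (w z)\<close> and adding it back as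
      \<open>grad \<Omega> q z + grad_perp \<Omega> \<psi> z\<close> pairs each discrete term with
      its exact counterpart.\<close>
    have eq: "f (v z) - grad \<Omega> p z - grad_perp \<Omega> \<mu> z = (f (v z) - f (w z)) + - ?P z + - ?N' z"
      unfolding elim(3-5) by simp
    have "(norm (f (v z) - grad \<Omega> p z - grad_perp \<Omega> \<mu> z))\<^sup>2 \<le>
        3 * ((norm (f (v z) - f (w z)))\<^sup>2 + (norm (?P z))\<^sup>2 + (norm (?N z))\<^sup>2)"
      unfolding eq using norm_add3_power2_le[of "f (v z) - f (w z)" "- ?P z" "- ?N' z"]
      by (simp add: norm_grad_perp)
    with lip[OF elim(1,2)] show ?case
      by simp
  qed
  \<comment> \<open>A Bochner integral is 0 by convention when its integrand is not integrable;
    nonnegativity of the majorant lets the comparison cover that case for the residual.\<close>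
  from le have nonneg:
    "AE z in ?M. 0 \<le> 3 * L * (norm (v z - w z))\<^sup>2 + 3 * (norm (?P z))\<^sup>2 + 3 * (norm (?N z))\<^sup>2"
    by eventually_elim (rule order_trans[OF zero_le_power2])
  have "(L2_norm ?M (\<lambda>z. f (v z) - grad \<Omega> p z - grad_perp \<Omega> \<mu> z))\<^sup>2 \<le>
      (LINT z|?M. 3 * L * (norm (v z - w z))\<^sup>2 + 3 * (norm (?P z))\<^sup>2 + 3 * (norm (?N z))\<^sup>2)"
    unfolding L2_norm_power2 by (rule integral_mono_AE'[OF int le nonneg])
  also have "\<dots> = 3 * L * (L2_norm ?M (\<lambda>z. v z - w z))\<^sup>2 + 3 * (L2_norm ?M ?P)\<^sup>2 +
      3 * (L2_norm ?M ?N)\<^sup>2"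
    using int_vw int_P int_N by (simp add: L2_norm_power2)
  finally have 1: "(L2_norm ?M (\<lambda>z. f (v z) - grad \<Omega> p z - grad_perp \<Omega> \<mu> z))\<^sup>2 \<le> \<dots>" .
  have "AE z in ?M. (norm (grad \<Omega> p z - grad \<Omega> q z))\<^sup>2 \<le> (norm (?P z))\<^sup>2"
    using diff_p(1) by eventually_elim simp
  then have "(L2_norm ?M (\<lambda>z. grad \<Omega> p z - grad \<Omega> q z))\<^sup>2 \<le> (L2_norm ?M ?P)\<^sup>2"
    unfolding L2_norm_power2 by (rule integral_mono_AE'[OF int_P]) simp
  with 1 show ?thesis
    unfolding LS_F_def by linarith
qed

lemma LS_F_nonneg: "0 \<le> LS_F \<Omega> f v p \<mu> q"
  by (simp add: LS_F_def)

text \<open>A real infimum lies below the values only for a set bounded below; 0 is such a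
  bound.\<close>

lemma LS_G_le_LS_F: "p \<in> V \<Longrightarrow> \<mu> \<in> W \<Longrightarrow> LS_G \<Omega> f V W v q \<le> LS_F \<Omega> f v p \<mu> q"
  unfolding LS_G_def
  by (rule cINF_lower2[where x = "(p, \<mu>)"]) (auto intro!: bdd_belowI[of _ 0] LS_F_nonneg)

lemma LS_G_nonneg: "V \<noteq> {} \<Longrightarrow> W \<noteq> {} \<Longrightarrow> 0 \<le> LS_G \<Omega> f V W v q"
  unfolding LS_G_def by (rule cINF_greatest) (auto intro: LS_F_nonneg)

text \<open>On the compact interval \<open>{-B..B}\<close> each of the two components contributes at
  most \<open>(K * \<bar>a - b\<bar>)\<^sup>2\<close>, which gives
  \<open>L = 2 * K\<^sup>2\<close>.\<close>

lemma locally_lipschitz_flux_bounded: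
  assumes "locally_lipschitz_flux f"
  obtains L where "L > 0"
    "\<And>a b. \<bar>a\<bar> \<le> B \<Longrightarrow> \<bar>b\<bar> \<le> B \<Longrightarrow> (norm (f a - f b))\<^sup>2 \<le> L * (a - b)\<^sup>2"
proof -
  obtain K where K: "K > 0" "\<And>a b. a \<in> {-B..B} \<Longrightarrow> b \<in> {-B..B} \<Longrightarrow>
      \<bar>fst (f a) - fst (f b)\<bar> \<le> K * \<bar>a - b\<bar> \<and> \<bar>snd (f a) - snd (f b)\<bar> \<le> K * \<bar>a - b\<bar>"
    using assms unfolding locally_lipschitz_flux_def by (meson compact_Icc)
  show ?thesis
  proof (rule that[of "2 * K\<^sup>2"])
    fix a b :: real
    assume "\<bar>a\<bar> \<le> B" "\<bar>b\<bar> \<le> B"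
    then have "\<bar>fst (f a - f b)\<bar> \<le> K * \<bar>a - b\<bar>" "\<bar>snd (f a - f b)\<bar> \<le> K * \<bar>a - b\<bar>"
      using K(2)[of a b] by (auto simp: abs_le_iff)
    then have "(fst (f a - f b))\<^sup>2 \<le> (K * \<bar>a - b\<bar>)\<^sup>2" "(snd (f a - f b))\<^sup>2 \<le> (K * \<bar>a - b\<bar>)\<^sup>2"
      using power_mono[OF _ abs_ge_zero, where n = 2] by fastforce+
    then show "(norm (f a - f b))\<^sup>2 \<le> 2 * K\<^sup>2 * (a - b)\<^sup>2"
      unfolding norm_prod_def by (simp add: power_mult_distrib)
  qed (use K in simp)
qed

theorem corollary5p4:
  fixes \<Omega> \<Gamma>\<^sub>I \<Gamma>\<^sub>C :: "(real \<times> real) set"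
    and f :: "real \<Rightarrow> real \<times> real"
    and r g uhat q \<psi> :: "real \<times> real \<Rightarrow> real"
    and h :: "nat \<Rightarrow> real"
    and U V\<^sub>C V\<^sub>I :: "nat \<Rightarrow> (real \<times> real \<Rightarrow> real) set"
    and u :: "nat \<Rightarrow> real \<times> real \<Rightarrow> real"
    and C\<^sub>0 \<beta>\<^sub>u \<beta>\<^sub>q \<beta>\<^sub>\<psi> B :: real
  assumes domain: "open \<Omega>" "bounded \<Omega>" "simply_connected \<Omega>" "lipschitz_boundary \<Omega>"
    and boundary: "boundary_partition \<Omega> \<Gamma>\<^sub>I \<Gamma>\<^sub>C"
    and flux: "locally_lipschitz_flux f"
    and data: "r \<in> L2 (lebesgue_on \<Omega>)" "g \<in> Linf (restrict_space (boundary_measure \<Omega>) \<Gamma>\<^sub>I)"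
    and mesh: "\<And>n. h n > 0" "h \<longlonglongrightarrow> 0"
    and spaces_fin: "\<And>n. finite_dim_space (U n)" "\<And>n. finite_dim_space (V\<^sub>C n)"
        "\<And>n. finite_dim_space (V\<^sub>I n)"
    and spaces_sub: "\<And>n. U n \<subseteq> Linf (lebesgue_on \<Omega>)" "\<And>n. V\<^sub>C n \<subseteq> H1_0 \<Omega> \<Gamma>\<^sub>C"
        "\<And>n. V\<^sub>I n \<subseteq> H1_0 \<Omega> \<Gamma>\<^sub>I"
    and solution: "weak_solution \<Omega> \<Gamma>\<^sub>I \<Gamma>\<^sub>C f r g uhat"
    and decomposition: "helmholtz_decomposition \<Omega> \<Gamma>\<^sub>I \<Gamma>\<^sub>C (\<lambda>z. f (uhat z)) q \<psi>"
    and constants: "C\<^sub>0 > 0" "\<beta>\<^sub>u > 0" "\<beta>\<^sub>q > 0" "\<beta>\<^sub>\<psi> > 0" "B > 0"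
    and regularity: "uhat \<in> sobolev \<Omega> \<beta>\<^sub>u" "q \<in> sobolev \<Omega> (\<beta>\<^sub>q + 1)" "\<psi> \<in> sobolev \<Omega> (\<beta>\<^sub>\<psi> + 1)"
    and uhat_bound: "Linf_norm (lebesgue_on \<Omega>) uhat \<le> ereal B"
    and approximation: "\<And>n. \<exists>uhat\<^sub>h\<in>U n. \<exists>qhat\<^sub>h\<in>V\<^sub>C n. \<exists>\<psi>hat\<^sub>h\<in>V\<^sub>I n.
          L2_norm (lebesgue_on \<Omega>) (\<lambda>z. uhat\<^sub>h z - uhat z)
            \<le> C\<^sub>0 * h n powr \<beta>\<^sub>u * sobolev_norm \<Omega> \<beta>\<^sub>u uhat \<and>
          L2_norm (lebesgue_on \<Omega>) (grad \<Omega> (\<lambda>z. qhat\<^sub>h z - q z))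
            \<le> C\<^sub>0 * h n powr \<beta>\<^sub>q * sobolev_norm \<Omega> (\<beta>\<^sub>q + 1) q \<and>
          L2_norm (lebesgue_on \<Omega>) (grad \<Omega> (\<lambda>z. \<psi>hat\<^sub>h z - \<psi> z))
            \<le> C\<^sub>0 * h n powr \<beta>\<^sub>\<psi> * sobolev_norm \<Omega> (\<beta>\<^sub>\<psi> + 1) \<psi> \<and>
          Linf_norm (lebesgue_on \<Omega>) uhat\<^sub>h \<le> ereal B"
    and minimizer: "\<And>n. u n \<in> U n"
        "\<And>n v. v \<in> U n \<Longrightarrow> LS_G \<Omega> f (V\<^sub>C n) (V\<^sub>I n) (u n) q \<le> LS_G \<Omega> f (V\<^sub>C n) (V\<^sub>I n) v q"
  shows "(\<exists>C>0. \<exists>C\<^sub>f\<^sub>B>0. \<forall>n.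
            LS_G \<Omega> f (V\<^sub>C n) (V\<^sub>I n) (u n) q
              \<le> C\<^sub>f\<^sub>B * h n powr (2 * \<beta>\<^sub>u) * (sobolev_norm \<Omega> \<beta>\<^sub>u uhat)\<^sup>2
                + C * h n powr (2 * \<beta>\<^sub>q) * (sobolev_norm \<Omega> (\<beta>\<^sub>q + 1) q)\<^sup>2
                + C * h n powr (2 * \<beta>\<^sub>\<psi>) * (sobolev_norm \<Omega> (\<beta>\<^sub>\<psi> + 1) \<psi>)\<^sup>2)
         \<and> (\<lambda>n. LS_G \<Omega> f (V\<^sub>C n) (V\<^sub>I n) (u n) q) \<longlonglongrightarrow> 0"

proof -
  let ?M = "lebesgue_on \<Omega>"
  let ?Nu = "sobolev_norm \<Omega> \<beta>\<^sub>u uhat" and ?Nq = "sobolev_norm \<Omega> (\<beta>\<^sub>q + 1) q"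
    and ?N\<psi> = "sobolev_norm \<Omega> (\<beta>\<^sub>\<psi> + 1) \<psi>"
  let ?G = "\<lambda>n. LS_G \<Omega> f (V\<^sub>C n) (V\<^sub>I n) (u n) q"
  obtain L where L: "L > 0"
      "\<And>a b. \<bar>a\<bar> \<le> B \<Longrightarrow> \<bar>b\<bar> \<le> B \<Longrightarrow> (norm (f a - f b))\<^sup>2 \<le> L * (a - b)\<^sup>2"
    using locally_lipschitz_flux_bounded[OF flux] by blast
  \<comment> \<open>These are the coefficients of \<open>LS_F_le\<close> times the squared
    approximation constant. Only \<open>D\<close> involves \<open>L\<close>, and so depends on
    \<open>f\<close> and \<open>B\<close>.\<close>
  define D where "D = 3 * L * C\<^sub>0\<^sup>2"
  define C where "C = 4 * C\<^sub>0\<^sup>2"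
  have pos: "D > 0" "C > 0"
    using L(1) constants(1) by (auto simp: D_def C_def)
  have sq: "x\<^sup>2 \<le> C\<^sub>0\<^sup>2 * (h n powr (2 * \<beta>) * N\<^sup>2)"
    if "0 \<le> x" "x \<le> C\<^sub>0 * h n powr \<beta> * N" for x \<beta> N n
  proof -
    have "(h n powr \<beta>)\<^sup>2 = h n powr (2 * \<beta>)"
      by (simp add: power2_eq_square flip: powr_add)
    with power_mono[OF that(2,1), of 2] show ?thesis
      by (simp add: power_mult_distrib mult.assoc)
  qed
  have bound: "?G n \<le> D * h n powr (2 * \<beta>\<^sub>u) * ?Nu\<^sup>2 + C * h n powr (2 * \<beta>\<^sub>q) * ?Nq\<^sup>2
      + C * h n powr (2 * \<beta>\<^sub>\<psi>) * ?N\<psi>\<^sup>2" for n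
  proof -
    obtain v p \<mu> where in_spaces: "v \<in> U n" "p \<in> V\<^sub>C n" "\<mu> \<in> V\<^sub>I n"
      and approx: "L2_norm ?M (\<lambda>z. v z - uhat z) \<le> C\<^sub>0 * h n powr \<beta>\<^sub>u * ?Nu"
        "L2_norm ?M (grad \<Omega> (\<lambda>z. p z - q z)) \<le> C\<^sub>0 * h n powr \<beta>\<^sub>q * ?Nq"
        "L2_norm ?M (grad \<Omega> (\<lambda>z. \<mu> z - \<psi> z)) \<le> C\<^sub>0 * h n powr \<beta>\<^sub>\<psi> * ?N\<psi>"
      and v: "Linf_norm ?M v \<le> ereal B"
      using approximation[of n] by blast
    have "?G n \<le> LS_G \<Omega> f (V\<^sub>C n) (V\<^sub>I n) v q"
      by (rule minimizer(2)[OF in_spaces(1)])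
    also have "\<dots> \<le> LS_F \<Omega> f v p \<mu> q"
      using in_spaces by (intro LS_G_le_LS_F)
    also have "\<dots> \<le> 3 * L * (L2_norm ?M (\<lambda>z. v z - uhat z))\<^sup>2 +
        4 * (L2_norm ?M (grad \<Omega> (\<lambda>z. p z - q z)))\<^sup>2 +
        3 * (L2_norm ?M (grad \<Omega> (\<lambda>z. \<mu> z - \<psi> z)))\<^sup>2"
    proof (rule LS_F_le[OF domain(1,2), where B = B])
      show "p \<in> sobolev \<Omega> 1" "\<mu> \<in> sobolev \<Omega> 1" "q \<in> sobolev \<Omega> 1" "\<psi> \<in> sobolev \<Omega> 1"
        using in_spaces spaces_sub[of n] decomposition
        by (auto simp: H1_0_def helmholtz_decomposition_def)
      show "v \<in> borel_measurable ?M" "uhat \<in> borel_measurable ?M"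
        using in_spaces spaces_sub(1)[of n] solution by (auto simp: weak_solution_def Linf_def)
      show "AE z in ?M. \<bar>v z\<bar> \<le> B" "AE z in ?M. \<bar>uhat z\<bar> \<le> B"
        using v uhat_bound by (auto intro: AE_le_Linf_norm)
      show "AE z in ?M. f (uhat z) = grad \<Omega> q z + grad_perp \<Omega> \<psi> z"
        using decomposition by (simp add: helmholtz_decomposition_def)
    qed (rule L(2))
    \<comment> \<open>The coefficient 3 of the \<open>\<psi>\<close> term is raised to 4 so that a
      single \<open>C\<close> serves both the \<open>q\<close> and the \<open>\<psi>\<close>
      terms.\<close>
    also have "\<dots> \<le> 3 * L * (C\<^sub>0\<^sup>2 * (h n powr (2 * \<beta>\<^sub>u) * ?Nu\<^sup>2)) +
        4 * (C\<^sub>0\<^sup>2 * (h n powr (2 * \<beta>\<^sub>q) * ?Nq\<^sup>2)) + 4 * (C\<^sub>0\<^sup>2 * (h n powr (2 * \<beta>\<^sub>\<psi>) * ?N\<psi>\<^sup>2))"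
      using L(1) approx
      by (intro add_mono mult_mono sq) (auto simp: L2_norm_def)
    finally show ?thesis
      by (simp add: D_def C_def mult.assoc)
  qed
  \<comment> \<open>The base tends to 0, where continuity of \<open>powr\<close> rests on the
    positive exponent and the nonnegative base.\<close>
  have "(\<lambda>n. h n powr (2 * \<beta>)) \<longlonglongrightarrow> 0" if "\<beta> > 0" for \<beta>
    using tendsto_powr'[OF mesh(2) tendsto_const[of "2 * \<beta>"]] that mesh(1)
    by (simp add: less_imp_le)
  note this[OF constants(2)] this[OF constants(3)] this[OF constants(4)]
  then have "(\<lambda>n. D * h n powr (2 * \<beta>\<^sub>u) * ?Nu\<^sup>2 + C * h n powr (2 * \<beta>\<^sub>q) * ?Nq\<^sup>2
      + C * h n powr (2 * \<beta>\<^sub>\<psi>) * ?N\<psi>\<^sup>2) \<longlonglongrightarrow> D * 0 * ?Nu\<^sup>2 + C * 0 * ?Nq\<^sup>2 + C * 0 * ?N\<psi>\<^sup>2"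
    by (intro tendsto_intros)
  then have upper: "(\<lambda>n. D * h n powr (2 * \<beta>\<^sub>u) * ?Nu\<^sup>2 + C * h n powr (2 * \<beta>\<^sub>q) * ?Nq\<^sup>2
      + C * h n powr (2 * \<beta>\<^sub>\<psi>) * ?N\<psi>\<^sup>2) \<longlonglongrightarrow> 0"
    by simp
  \<comment> \<open>The infimum is bounded below by 0 once it ranges over a nonempty set; the
    approximants witness this, and the lower half of the squeeze follows.\<close>
  have "V\<^sub>C n \<noteq> {}" "V\<^sub>I n \<noteq> {}" for n
    using approximation[of n] by auto
  then have "?G \<longlonglongrightarrow> 0"
    by (intro tendsto_sandwich[OF _ _ tendsto_const upper] always_eventually allI bound LS_G_nonneg)
  with pos bound show ?thesis
    by (intro conjI exI[of _ C] exI[of _ D] allI)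
qed

end
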